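(* Let $n\ge 1$ be an even integer, let $f$ be a smooth real-valued function of one real variable, and let $I\subset\mathbb{R}$ be an interval (possibly infinite) such that $f^{(n+1)}(t)\neq 0$ for all $t\in I$. For $t\in I$ let $g_t$ be the osculating (Taylor) polynomial of degree $n$ of $f$ at $t$. Then for any distinct $a,b\in I$, the graphs of the polynomials $g_a$ and $g_b$ (as functions on all of $\mathbb{R}$) are disjoint.
   Context: The osculating (Taylor) polynomial of degree $n$ of $f$ at the point $t$ is $$g_t(x)=\sum_{i=0}^n \frac{f^{(i)}(t)}{i!}(x-t)^i ,\qquad x\in\mathbb{R},$$ i.e. the polynomial whose value and first $n$ derivatives at $t$ coincide with those of $f$. *)

theory Defs
  imports "HOL-Analysis.Analysis"
begin

text \<open>
  \<open>smooth_on\<close> is meant for open \<open>U\<close>: there \<^term>\<open>deriv\<close>, which is defined by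
  two-sided limits, depends only on the values of \<open>f\<close> on \<open>U\<close>.
\<close>

definition smooth_on :: "real set \<Rightarrow> (real \<Rightarrow> real) \<Rightarrow> bool" where
  "smooth_on U f \<longleftrightarrow> (\<forall>k. \<forall>x\<in>U. (deriv ^^ k) f differentiable (at x))"

definition osculating :: "nat \<Rightarrow> (real \<Rightarrow> real) \<Rightarrow> real \<Rightarrow> real \<Rightarrow> real" where
  "osculating n f t x = (\<Sum>i\<le>n. (deriv ^^ i) f t / fact i * (x - t) ^ i)"

definition graph :: "(real \<Rightarrow> real) \<Rightarrow> (real \<times> real) set" where
  "graph g = range (\<lambda>x. (x, g x))"

end

theory Submission
  imports Defs
begin

text \<open>
  Two graphs meet exactly when \<open>g\<^sub>a(x) = g\<^sub>b(x)\<close> for some \<open>x\<close>. Fix \<open>x\<close> and let the base point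
  \<open>t\<close> of the Taylor polynomial vary. The derivative of \<open>g\<^sub>t(x)\<close> in \<open>t\<close> telescopes to
  \<open>f\<^bsup>(n+1)\<^esup>(t) / n! \<cdot> (x - t)\<^sup>n\<close> (lemma \<open>osculating_deriv_base_point\<close>). On the interval the factor
  \<open>f\<^bsup>(n+1)\<^esup>\<close> is continuous and nowhere zero, hence of constant sign, and \<open>(x - t)\<^sup>n > 0\<close> for
  \<open>t \<noteq> x\<close> because \<open>n\<close> is even. So the derivative has one and the same sign away from the single
  point \<open>t = x\<close>, which makes \<open>t \<mapsto> g\<^sub>t(x)\<close> injective on the interval
  (lemma \<open>deriv_same_sign_off_point_imp_neq\<close>).
\<close>

lemma osculating_deriv_base_point:
  assumes "\<And>k. k \<le> n \<Longrightarrow> (deriv ^^ k) f differentiable (at t)"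
  shows "((\<lambda>t. osculating n f t x) has_real_derivative
           (deriv ^^ (n + 1)) f t / fact n * (x - t) ^ n) (at t)"
  using assms
proof (induction n)
  case 0
  then have "f differentiable (at t)"
    using "0.prems"[of 0] by simp
  then show ?case
    by (simp add: osculating_def DERIV_deriv_iff_real_differentiable)
next
  case (Suc n)
  let ?d = "\<lambda>k. (deriv ^^ k) f"
  have IH: "((\<lambda>t. osculating n f t x) has_real_derivative ?d (n + 1) t / fact n * (x - t) ^ n) (at t)"
    using Suc by simp
  have d: "(?d (Suc n) has_real_derivative ?d (Suc (Suc n)) t) (at t)"
    using Suc.prems[of "Suc n"] by (simp add: DERIV_deriv_iff_real_differentiable)
  have pow: "((\<lambda>t. (x - t) ^ Suc n) has_real_derivative real (Suc n) * (x - t) ^ n * (-1)) (at t)"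
    by (rule derivative_eq_intros refl | simp)+
  have "((\<lambda>t. osculating n f t x + ?d (Suc n) t / fact (Suc n) * (x - t) ^ Suc n)
          has_real_derivative
          ?d (n + 1) t / fact n * (x - t) ^ n +
          (?d (Suc (Suc n)) t / fact (Suc n) * (x - t) ^ Suc n +
           real (Suc n) * (x - t) ^ n * (-1) * (?d (Suc n) t / fact (Suc n)))) (at t)"
    by (intro DERIV_add[OF IH] DERIV_mult DERIV_cdivide[OF d] pow)
  moreover have "real (Suc n) * (x - t) ^ n * (-1) * (?d (Suc n) t / fact (Suc n)) =
      - (?d (n + 1) t / fact n * (x - t) ^ n)"
    by (simp add: fact_Suc divide_simps del: funpow.simps of_nat_Suc)
  moreover have "(\<lambda>t. osculating (Suc n) f t x) =
      (\<lambda>t. osculating n f t x + ?d (Suc n) t / fact (Suc n) * (x - t) ^ Suc n)"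
    by (simp add: osculating_def del: funpow.simps)
  ultimately show ?case
    by (simp del: funpow.simps fact_Suc)
qed

lemma continuous_nonzero_same_sign:
  fixes g :: "real \<Rightarrow> real"
  assumes "is_interval I" "continuous_on I g" "\<And>t. t \<in> I \<Longrightarrow> g t \<noteq> 0" "u \<in> I" "v \<in> I"
  shows "g u * g v > 0"
proof -
  have "connected (g ` I)"
    using assms by (simp add: connected_continuous_image is_interval_connected)
  then have "is_interval (g ` I)"
    by (simp add: is_interval_connected_1)
  then have "0 \<in> g ` I" if "p \<in> I" "q \<in> I" "g p < 0" "0 < g q" for p q
    using that unfolding is_interval_1 by (meson imageI less_imp_le)
  then have no_change: "\<not> (g p < 0 \<and> 0 < g q)" if "p \<in> I" "q \<in> I" for p q
    using that assms(3) by fastforce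
  from no_change[of u v] no_change[of v u] assms(3)[of u] assms(3)[of v] assms(4,5)
  show ?thesis
    by (auto simp: zero_less_mult_iff)
qed

text \<open>
  The exceptional point \<open>x\<close> may carry a zero of the derivative; the mean value theorem is applied
  on the two sides of it separately.
\<close>
lemma deriv_same_sign_off_point_imp_neq:
  fixes h h' :: "real \<Rightarrow> real"
  assumes "a < b"
    and der: "\<And>t. a \<le> t \<Longrightarrow> t \<le> b \<Longrightarrow> (h has_real_derivative h' t) (at t)"
    and sign: "\<And>u v. u \<in> {a..b} - {x} \<Longrightarrow> v \<in> {a..b} - {x} \<Longrightarrow> h' u * h' v > 0"
  shows "h a \<noteq> h b"
proof (cases "a < x \<and> x < b")
  case False
  obtain z where z: "a < z" "z < b" "h b - h a = (b - a) * h' z"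
    using MVT2[OF \<open>a < b\<close> der] by blast
  then have "h' z \<noteq> 0"
    using False sign[of z z] by auto
  then show ?thesis
    using z by auto
next
  case True
  obtain y where y: "a < y" "y < x" "h x - h a = (x - a) * h' y"
    using MVT2[of a x h h'] der True by auto
  obtain z where z: "x < z" "z < b" "h b - h x = (b - x) * h' z"
    using MVT2[of x b h h'] der True by auto
  have "h' y * h' z > 0"
    using y z True by (intro sign) auto
  then have "(h x - h a) * (h b - h x) > 0"
    using True y(3) z(3) by (auto simp: zero_less_mult_iff mult_less_0_iff)
  then show ?thesis
    by (auto simp: zero_less_mult_iff)
qed

lemma osculating_neq_of_less:
  fixes f :: "real \<Rightarrow> real"
  assumes "even n" "smooth_on U f" "is_interval I" "I \<subseteq> U"
    and nz: "\<And>t. t \<in> I \<Longrightarrow> (deriv ^^ (n + 1)) f t \<noteq> 0"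
    and "a \<in> I" "b \<in> I" "a < b"
  shows "osculating n f a x \<noteq> osculating n f b x"
proof (rule deriv_same_sign_off_point_imp_neq[OF \<open>a < b\<close>])
  let ?g = "(deriv ^^ (n + 1)) f"
  let ?h' = "\<lambda>t. ?g t / fact n * (x - t) ^ n"
  have I: "t \<in> I" if "a \<le> t" "t \<le> b" for t
    using that assms(3,6,7) by (meson is_interval_1)
  have diff: "(deriv ^^ k) f differentiable (at t)" if "t \<in> I" for k t
    using that assms(2,4) unfolding smooth_on_def by blast
  show "((\<lambda>t. osculating n f t x) has_real_derivative ?h' t) (at t)"
    if "a \<le> t" "t \<le> b" for t
    using that by (intro osculating_deriv_base_point diff I)
  have cont: "continuous_on I ?g"
    by (intro continuous_at_imp_continuous_on ballI differentiable_imp_continuous_within diff)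
  show "?h' u * ?h' v > 0" if "u \<in> {a..b} - {x}" "v \<in> {a..b} - {x}" for u v
  proof -
    have "u \<in> I" "v \<in> I"
      using that by (auto intro: I)
    then have "?g u * ?g v > 0"
      using continuous_nonzero_same_sign[OF assms(3) cont] nz by blast
    moreover have "(x - u) ^ n > 0" "(x - v) ^ n > 0"
      using that \<open>even n\<close> by (auto simp: zero_less_power_eq)
    ultimately have "(?g u * ?g v) * ((x - u) ^ n * (x - v) ^ n) / (fact n * fact n) > 0"
      by (rule divide_pos_pos[OF mult_pos_pos[OF _ mult_pos_pos]]) simp
    then show ?thesis
      by (simp add: mult_ac del: funpow.simps)
  qed
qed

theorem theorem1:
  fixes n :: nat and f :: "real \<Rightarrow> real" and U I :: "real set" and a b :: real
  assumes "n \<ge> 1" and "even n"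
    and "open U" and "smooth_on U f"
    and "is_interval I" and "I \<subseteq> U"
    and "\<And>t. t \<in> I \<Longrightarrow> (deriv ^^ (n + 1)) f t \<noteq> 0"
    and "a \<in> I" and "b \<in> I" and "a \<noteq> b"
  shows "graph (osculating n f a) \<inter> graph (osculating n f b) = {}"
proof -
  note neq = osculating_neq_of_less[OF assms(2,4,5,6,7)]
  have "osculating n f a x \<noteq> osculating n f b x" for x
    using neq[of a b x] neq[of b a x] assms(8-10) by (cases "a < b") auto
  then show ?thesis
    by (auto simp: graph_def)
qed

end
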